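(* Let $(\mathcal{X},T)$ be a dynamical system with a metric $d$ and an invariant probability measure $\mu$. Let $\mathcal{F}=\{\varphi_n\}_{n=1}^\infty$ be a sub-additive potential on $\mathcal{X}$ such that $\mathcal{F}_*(\mu)\ne-\infty$. Then $$\overline{\mathrm{rdim}}(\mathcal{X},T,d,\mu)+\mathcal{F}_*(\mu)\le\overline{\mathrm{mdim}}_M(\mathcal{X},T,d,\mathcal{F}),$$ $$\underline{\mathrm{rdim}}(\mathcal{X},T,d,\mu)+\mathcal{F}_*(\mu)\le\underline{\mathrm{mdim}}_M(\mathcal{X},T,d,\mathcal{F}).$$
   Context: A dynamical system $(\mathcal{X},T)$ is a compact metrizable space $\mathcal{X}$ with a homeomorphism $T:\mathcal{X}\to\mathcal{X}$; metrics on $\mathcal{X}$ are compatible with the topology, and invariant measures are $T$-invariant Borel probability measures. For a metric $d$ and $N\ge1$, $d_N(x,y)=\max_{0\le n<N}d(T^nx,T^ny)$. Sub-additive potential: a sequence $\mathcal{F}=\{\varphi_n\}_{n\ge1}$ of continuous functions $\varphi_n:\mathcal{X}\to\mathbb{R}$ with $\varphi_{n+m}(x)\le\varphi_n(x)+\varphi_m(T^nx)$ for all $x\in\mathcal{X}$, $m,n\in\mathbb{N}$. $\mathcal{F}_*(\mu)=\lim_{n\to\infty}\frac1n\int\varphi_n\,d\mu\in[-\infty,\infty)$ (exists by subadditivity). Metric mean dimension with potential: for continuous $\varphi:\mathcal{X}\to\mathbb{R}$ and $\epsilon>0$, $$\#(\mathcal{X},d,\varphi,\epsilon)=\inf\Big\{\sum_{i=1}^n(1/\epsilon)^{\sup_{U_i}\varphi}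 : \mathcal{X}=U_1\cup\dots\cup U_n\text{ an open cover with }\mathrm{diam}\,U_i<\epsilon\text{ for all }i\Big\},$$ $P(\mathcal{X},T,d,\mathcal{F},\epsilon)=\lim_{N\to\infty}\frac{\log\#(\mathcal{X},d_N,\varphi_N,\epsilon)}{N}$ (the limit exists by subadditivity), and $\overline{\mathrm{mdim}}_M(\mathcal{X},T,d,\mathcal{F})$, $\underline{\mathrm{mdim}}_M(\mathcal{X},T,d,\mathcal{F})$ are respectively the $\limsup$ and $\liminf$ as $\epsilon\to0$ of $\frac{P(\mathcal{X},T,d,\mathcal{F},\epsilon)}{\log(1/\epsilon)}$. Rate distortion dimension: for random variables $X,Y$ taking values in measurable spaces, the mutual information $I(X;Y)$ is the supremum of $I(f\circ X;g\circ Y)$ over measurable maps $f,g$ with finite range, where for finite-valued variables $I(X;Y)=H(X)+H(Y)-H(X,Y)$ ($H$ = Shannon entropy). For $\epsilon>0$, $R_\mu(\epsilon)=R(d,\mu,\epsilon)$ is the infimum of $I(X;Y)/n$ over all $n\in\mathbb{N}$ and all random variables $X$ and $Y=(Y_0,\dots,Y_{n-1})$ on some probability space such that $X$ takes values in $\mathcal{X}$ with law $\mu$, each $Y_k$ takes values in $\mathcal{X}$, and $\mathbb{E}\left(\frac1n\sum_{k=0}^{n-1}d(T^kX,Y_k)\right)<\epsilon$. Then $\overline{\mathrm{rdim}}(\mathcal{X},T,d,\mu)=\limsup_{\epsilon\to0}R_\mu(\epsilon)/\log(1/\epsilon)$ and $\underline{\mathrm{rdim}}(\mathcal{X},T,d,\mu)=\liminf_{\epsilon\to0}R_\mu(\epsilon)/\log(1/\epsilon)$.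 *)

theory Defs
  imports "HOL-Probability.Probability"
begin

section \<open>Dynamical systems and sub-additive potentials\<close>

definition dynamical_system :: "('a::topological_space \<Rightarrow> 'a) \<Rightarrow> bool" where
  "dynamical_system T \<longleftrightarrow>
     compact (UNIV :: 'a set) \<and> metrizable_space (euclidean :: 'a topology) \<and>
     homeomorphic_map euclidean euclidean T"

definition compatible_metric :: "('a::topological_space \<Rightarrow> 'a \<Rightarrow> real) \<Rightarrow> bool" where
  "compatible_metric d \<longleftrightarrow> Metric_space UNIV d \<and> Metric_space.mtopology UNIV d = euclidean"

definition invariant_probability :: "('a::topological_space \<Rightarrow> 'a) \<Rightarrow> 'a measure \<Rightarrow> bool" where
  "invariant_probability T \<mu> \<longleftrightarrow>
     prob_space \<mu> \<and> sets \<mu> = sets borel \<and> distr \<mu> borel T = \<mu>"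

text \<open>Potentials are indexed from 1; the value at index 0 is unconstrained and never used.\<close>

definition subadditive_potential ::
    "('a::topological_space \<Rightarrow> 'a) \<Rightarrow> (nat \<Rightarrow> 'a \<Rightarrow> real) \<Rightarrow> bool" where
  "subadditive_potential T \<phi> \<longleftrightarrow>
     (\<forall>n\<ge>1. continuous_on UNIV (\<phi> n)) \<and>
     (\<forall>n\<ge>1. \<forall>m\<ge>1. \<forall>x. \<phi> (n + m) x \<le> \<phi> n x + \<phi> m ((T ^^ n) x))"

definition potential_mean :: "(nat \<Rightarrow> 'a \<Rightarrow> real) \<Rightarrow> 'a measure \<Rightarrow> ereal" where
  "potential_mean \<phi> \<mu> = lim (\<lambda>n. ereal ((\<integral>x. \<phi> n x \<partial>\<mu>) / real n))"


section \<open>Metric mean dimension with potential\<close>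

text \<open>Only meant for positive \<open>N\<close>.\<close>

definition dyn_metric :: "('a \<Rightarrow> 'a) \<Rightarrow> ('a \<Rightarrow> 'a \<Rightarrow> real) \<Rightarrow> nat \<Rightarrow> 'a \<Rightarrow> 'a \<Rightarrow> real" where
  "dyn_metric T d N x y = (MAX n\<in>{..<N}. d ((T ^^ n) x) ((T ^^ n) y))"

definition diam :: "('a \<Rightarrow> 'a \<Rightarrow> real) \<Rightarrow> 'a set \<Rightarrow> real" where
  "diam d U = (SUP (x, y)\<in>U \<times> U. d x y)"

text \<open>The members of a cover are required to be nonempty, so that the real suprema below are
  meaningful. For \<open>\<epsilon> < 1\<close>, the only case relevant for \<open>\<epsilon> \<longlongrightarrow> 0\<close>, this does not affect the infimum:
  an empty member would have supremum \<open>- \<infinity>\<close> and contribute \<open>(1/\<epsilon>)\<close> to the power \<open>- \<infinity>\<close>, that is, \<open>0\<close>.\<close>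

definition covering_sum ::
    "('a::topological_space \<Rightarrow> 'a \<Rightarrow> real) \<Rightarrow> ('a \<Rightarrow> real) \<Rightarrow> real \<Rightarrow> real" where
  "covering_sum d \<phi> \<epsilon> =
     Inf {(\<Sum>i<n. (1 / \<epsilon>) powr (SUP x\<in>U i. \<phi> x)) | (n :: nat) (U :: nat \<Rightarrow> 'a set).
            (\<Union>i<n. U i) = UNIV \<and> (\<forall>i<n. open (U i) \<and> U i \<noteq> {} \<and> diam d (U i) < \<epsilon>)}"

definition pressure ::
    "('a::topological_space \<Rightarrow> 'a) \<Rightarrow> ('a \<Rightarrow> 'a \<Rightarrow> real) \<Rightarrow> (nat \<Rightarrow> 'a \<Rightarrow> real) \<Rightarrow> real \<Rightarrow> ereal" where
  "pressure T d \<phi> \<epsilon> =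
     lim (\<lambda>N. ereal (ln (covering_sum (dyn_metric T d N) (\<phi> N) \<epsilon>) / real N))"

definition upper_mdim ::
    "('a::topological_space \<Rightarrow> 'a) \<Rightarrow> ('a \<Rightarrow> 'a \<Rightarrow> real) \<Rightarrow> (nat \<Rightarrow> 'a \<Rightarrow> real) \<Rightarrow> ereal" where
  "upper_mdim T d \<phi> = Limsup (at_right 0) (\<lambda>\<epsilon>. pressure T d \<phi> \<epsilon> / ereal (ln (1 / \<epsilon>)))"

definition lower_mdim ::
    "('a::topological_space \<Rightarrow> 'a) \<Rightarrow> ('a \<Rightarrow> 'a \<Rightarrow> real) \<Rightarrow> (nat \<Rightarrow> 'a \<Rightarrow> real) \<Rightarrow> ereal" where
  "lower_mdim T d \<phi> = Liminf (at_right 0) (\<lambda>\<epsilon>. pressure T d \<phi> \<epsilon> / ereal (ln (1 / \<epsilon>)))"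


section \<open>Rate distortion dimension\<close>

text \<open>Entropy is taken to the base \<open>e\<close>, matching the natural logarithm in \<open>log (1/\<epsilon>)\<close>.\<close>

definition shannon_entropy :: "'w measure \<Rightarrow> ('w \<Rightarrow> 'c) \<Rightarrow> real" where
  "shannon_entropy M X = prob_space.entropy M (exp 1) (count_space (X ` space M)) X"

text \<open>A finite set of values can be relabelled by natural numbers without changing entropies, so
  the quantizers \<open>f\<close> and \<open>g\<close> may be taken \<open>nat\<close>-valued.\<close>

definition mutual_info ::
    "'w measure \<Rightarrow> 'b measure \<Rightarrow> 'c measure \<Rightarrow> ('w \<Rightarrow> 'b) \<Rightarrow> ('w \<Rightarrow> 'c) \<Rightarrow> ereal" where
  "mutual_info M S S' X Y =
     Sup {ereal (shannon_entropy M (f \<circ> X) + shannon_entropy M (g \<circ> Y)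
                 - shannon_entropy M (\<lambda>\<omega>. (f (X \<omega>), g (Y \<omega>)))) | (f :: 'b \<Rightarrow> nat) (g :: 'c \<Rightarrow> nat).
            f \<in> measurable S (count_space UNIV) \<and> finite (f ` space S) \<and>
            g \<in> measurable S' (count_space UNIV) \<and> finite (g ` space S')}"

definition rate_admissible ::
    "('a::topological_space \<Rightarrow> 'a) \<Rightarrow> ('a \<Rightarrow> 'a \<Rightarrow> real) \<Rightarrow> 'a measure \<Rightarrow> real \<Rightarrow>
     nat \<Rightarrow> 'w measure \<Rightarrow> ('w \<Rightarrow> 'a) \<Rightarrow> ('w \<Rightarrow> nat \<Rightarrow> 'a) \<Rightarrow> bool" where
  "rate_admissible T d \<mu> \<epsilon> n M X Y \<longleftrightarrow>
     n \<ge> 1 \<and> prob_space M \<and> X \<in> measurable M borel \<and> distr M borel X = \<mu> \<and>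
     Y \<in> measurable M (PiM {..<n} (\<lambda>_. borel)) \<and>
     prob_space.expectation M (\<lambda>\<omega>. (\<Sum>k<n. d ((T ^^ k) (X \<omega>)) (Y \<omega> k)) / real n) < \<epsilon>"

text \<open>HOL cannot quantify over the type of sample points inside a formula, so the probability
  spaces range over those on the type \<open>'a \<times> (nat \<Rightarrow> 'a)\<close>, which is large enough to carry the joint
  law of every \<open>(X, Y)\<close>. Nothing is lost: lemma \<open>rate_distortion_le\<close> below shows
  that pairs on a probability space over an arbitrary type give no smaller values.\<close>

definition rate_distortion ::
    "('a::topological_space \<Rightarrow> 'a) \<Rightarrow> ('a \<Rightarrow> 'a \<Rightarrow> real) \<Rightarrow> 'a measure \<Rightarrow> real \<Rightarrow> ereal" where
  "rate_distortion T d \<mu> \<epsilon> =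
     Inf {mutual_info M borel (PiM {..<n} (\<lambda>_. borel)) X Y / ereal (real n) | n
            (M :: ('a \<times> (nat \<Rightarrow> 'a)) measure) X Y. rate_admissible T d \<mu> \<epsilon> n M X Y}"

definition upper_rdim ::
    "('a::topological_space \<Rightarrow> 'a) \<Rightarrow> ('a \<Rightarrow> 'a \<Rightarrow> real) \<Rightarrow> 'a measure \<Rightarrow> ereal" where
  "upper_rdim T d \<mu> = Limsup (at_right 0) (\<lambda>\<epsilon>. rate_distortion T d \<mu> \<epsilon> / ereal (ln (1 / \<epsilon>)))"

definition lower_rdim ::
    "('a::topological_space \<Rightarrow> 'a) \<Rightarrow> ('a \<Rightarrow> 'a \<Rightarrow> real) \<Rightarrow> 'a measure \<Rightarrow> ereal" where
  "lower_rdim T d \<mu> = Liminf (at_right 0) (\<lambda>\<epsilon>. rate_distortion T d \<mu> \<epsilon> / ereal (ln (1 / \<epsilon>)))"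


subsection \<open>Independence of the sample space\<close>

lemma shannon_entropy_finite:
  assumes "prob_space M" and X: "X \<in> measurable M (count_space UNIV)"
    and A: "finite A" "X ` space M \<subseteq> A"
  shows "shannon_entropy M X =
    - (\<Sum>a\<in>A. measure M (X -` {a} \<inter> space M) * ln (measure M (X -` {a} \<inter> space M)))"
proof -
  interpret information_space M "exp 1"
    using assms(1) by (simp add: information_space_def information_space_axioms_def)
  have "simple_function M X"
    unfolding simple_function_def
    using A finite_subset measurable_sets[OF X] by auto
  then have "shannon_entropy M X = - (\<Sum>a\<in>X ` space M.
      measure M (X -` {a} \<inter> space M) * log (exp 1) (measure M (X -` {a} \<inter> space M)))"
    unfolding shannon_entropy_def
    by (intro entropy_simple_distributed simple_distributedI) auto
  also have "\<dots> = - (\<Sum>a\<in>A. measure M (X -` {a} \<inter> space M) * ln (measure M (X -` {a} \<inter> space M)))"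
    unfolding log_def ln_exp div_by_1
  proof (intro arg_cong[where f = uminus] sum.mono_neutral_left A ballI)
    fix a assume "a \<in> A - X ` space M"
    then have "X -` {a} \<inter> space M = {}" by auto
    then show "measure M (X -` {a} \<inter> space M) * ln (measure M (X -` {a} \<inter> space M)) = 0" by simp
  qed
  finally show ?thesis .
qed

lemma shannon_entropy_distr:
  assumes M: "prob_space M" and Z: "Z \<in> measurable M S"
    and h: "h \<in> measurable S (count_space UNIV)" "finite (h ` space S)"
  shows "shannon_entropy (distr M S Z) h = shannon_entropy M (h \<circ> Z)"
proof -
  have "measure (distr M S Z) (h -` {a} \<inter> space S) = measure M ((h \<circ> Z) -` {a} \<inter> space M)" for a
  proof -
    have "Z -` (h -` {a} \<inter> space S) \<inter> space M = (h \<circ> Z) -` {a} \<inter> space M"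
      using measurable_space[OF Z] by auto
    then show ?thesis
      using measurable_sets[OF h(1)] by (subst measure_distr[OF Z]) auto
  qed
  then show ?thesis
    using measurable_space[OF Z] measurable_comp[OF Z h(1)] h
    by (subst (1 2) shannon_entropy_finite[where A = "h ` space S"])
      (auto intro: prob_space.prob_space_distr[OF M Z] M)
qed

lemma mutual_info_distr:
  assumes M: "prob_space M" and X: "X \<in> measurable M S" and Y: "Y \<in> measurable M S'"
  shows "mutual_info (distr M (S \<Otimes>\<^sub>M S') (\<lambda>\<omega>. (X \<omega>, Y \<omega>))) S S' fst snd = mutual_info M S S' X Y"
proof -
  let ?Z = "\<lambda>\<omega>. (X \<omega>, Y \<omega>)" and ?P = "S \<Otimes>\<^sub>M S'"
  have Z: "?Z \<in> measurable M ?P" using X Y by measurable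
  have *: "shannon_entropy (distr M ?P ?Z) (f \<circ> fst) = shannon_entropy M (f \<circ> X) \<and>
        shannon_entropy (distr M ?P ?Z) (g \<circ> snd) = shannon_entropy M (g \<circ> Y) \<and>
        shannon_entropy (distr M ?P ?Z) (\<lambda>\<omega>. (f (fst \<omega>), g (snd \<omega>))) =
          shannon_entropy M (\<lambda>\<omega>. (f (X \<omega>), g (Y \<omega>)))"
    if f: "f \<in> measurable S (count_space UNIV)" "finite (f ` space S)"
      and g: "g \<in> measurable S' (count_space UNIV)" "finite (g ` space S')"
    for f :: "'b \<Rightarrow> nat" and g :: "'c \<Rightarrow> nat"
  proof (intro conjI)
    have "(f \<circ> fst) ` space ?P \<subseteq> f ` space S" by (auto simp: space_pair_measure)
    then show "shannon_entropy (distr M ?P ?Z) (f \<circ> fst) = shannon_entropy M (f \<circ> X)"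
      using shannon_entropy_distr[OF M Z, of "f \<circ> fst"] f finite_subset
        measurable_comp[OF measurable_fst f(1)] by (auto simp: comp_def)
    have "(g \<circ> snd) ` space ?P \<subseteq> g ` space S'" by (auto simp: space_pair_measure)
    then show "shannon_entropy (distr M ?P ?Z) (g \<circ> snd) = shannon_entropy M (g \<circ> Y)"
      using shannon_entropy_distr[OF M Z, of "g \<circ> snd"] g finite_subset
        measurable_comp[OF measurable_snd g(1)] by (auto simp: comp_def)
    have "(\<lambda>\<omega>. (f (fst \<omega>), g (snd \<omega>))) ` space ?P \<subseteq> f ` space S \<times> g ` space S'"
      by (auto simp: space_pair_measure)
    then have fin: "finite ((\<lambda>\<omega>. (f (fst \<omega>), g (snd \<omega>))) ` space ?P)"
      using f g finite_subset by blast
    have "(\<lambda>\<omega>. (f (fst \<omega>), g (snd \<omega>))) \<in> measurable ?P (count_space UNIV \<Otimes>\<^sub>M count_space UNIV)"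
      using f(1) g(1) by measurable
    then have "(\<lambda>\<omega>. (f (fst \<omega>), g (snd \<omega>))) \<in> measurable ?P (count_space UNIV)"
      by (simp add: pair_measure_countable)
    from shannon_entropy_distr[OF M Z this fin]
    show "shannon_entropy (distr M ?P ?Z) (\<lambda>\<omega>. (f (fst \<omega>), g (snd \<omega>))) =
          shannon_entropy M (\<lambda>\<omega>. (f (X \<omega>), g (Y \<omega>)))"
      by (simp add: comp_def)
  qed
  show ?thesis
    unfolding mutual_info_def
    by (intro arg_cong[where f = Sup] Collect_cong ex_cong1 rev_conj_cong refl)
      (elim conjE, frule (3) *, simp)
qed

lemma measurable_compatible_metric:
  fixes d :: "'a::topological_space \<Rightarrow> 'a \<Rightarrow> real"
  assumes d: "compatible_metric d" and "compact (UNIV :: 'a set)"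
    and F: "F \<in> measurable M borel" and G: "G \<in> measurable M borel"
  shows "(\<lambda>\<omega>. d (F \<omega>) (G \<omega>)) \<in> borel_measurable M"
proof -
  interpret Metric_space UNIV d using d by (simp add: compatible_metric_def)
  have top: "mtopology = euclidean" using d by (simp add: compatible_metric_def)
  have ball: "open (mball q r)" for q r
    using openin_mball[of q r] unfolding top by (simp only: open_openin)
  have "\<exists>K. finite K \<and> (\<Union>q\<in>K. mball q (1 / real (Suc n))) = UNIV" for n
  proof -
    have "UNIV \<subseteq> (\<Union>q\<in>UNIV. mball q (1 / real (Suc n)))" by auto
    with assms(2) ball obtain K
      where "finite K" "UNIV \<subseteq> (\<Union>q\<in>K. mball q (1 / real (Suc n)))"
      by (elim compactE_image) auto
    then show ?thesis by blast
  qed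
  then obtain K where K: "\<And>n. finite (K n)" "\<And>n. (\<Union>q\<in>K n. mball q (1 / real (Suc n))) = UNIV"
    by metis
  define Q where "Q = (\<Union>n. K n)"
  have Q: "countable Q" unfolding Q_def using K(1) by (auto intro: countable_finite)
  have meas: "(\<lambda>\<omega>. d q (H \<omega>)) \<in> borel_measurable M" if H: "H \<in> measurable M borel" for q H
  proof -
    have "d q -` {..<c} = mball q c" for c by auto
    then have "d q \<in> borel_measurable borel"
      using ball by (auto intro!: borel_measurableI_less simp: vimage_def lessThan_def)
    then show ?thesis using H by measurable
  qed
  have *: "d (F \<omega>) (G \<omega>) < c \<longleftrightarrow> (\<exists>q\<in>Q. d q (F \<omega>) + d q (G \<omega>) < c)" for \<omega> c
  proof
    assume "d (F \<omega>) (G \<omega>) < c"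
    then obtain n where n: "1 / real (Suc n) < (c - d (F \<omega>) (G \<omega>)) / 2"
      by (metis diff_gt_0_iff_gt half_gt_zero nat_approx_posE)
    have "F \<omega> \<in> (\<Union>q\<in>K n. mball q (1 / real (Suc n)))" unfolding K(2) by simp
    then obtain q where q: "q \<in> K n" "d q (F \<omega>) < 1 / real (Suc n)" by auto
    have "d q (G \<omega>) \<le> d q (F \<omega>) + d (F \<omega>) (G \<omega>)" by (rule triangle) auto
    then have "d q (F \<omega>) + d q (G \<omega>) < c" using n q(2) by argo
    then show "\<exists>q\<in>Q. d q (F \<omega>) + d q (G \<omega>) < c" using q(1) unfolding Q_def by blast
  next
    assume "\<exists>q\<in>Q. d q (F \<omega>) + d q (G \<omega>) < c"
    then obtain q where "d q (F \<omega>) + d q (G \<omega>) < c" by blast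
    moreover have "d (F \<omega>) (G \<omega>) \<le> d (F \<omega>) q + d q (G \<omega>)" by (rule triangle) auto
    ultimately show "d (F \<omega>) (G \<omega>) < c" by (simp add: commute)
  qed
  show ?thesis
  proof (rule borel_measurableI_less)
    fix c
    have "{\<omega> \<in> space M. d (F \<omega>) (G \<omega>) < c} = (\<Union>q\<in>Q. {\<omega> \<in> space M. d q (F \<omega>) + d q (G \<omega>) < c})"
      using * by auto
    also have "\<dots> \<in> sets M"
      using meas[OF F] meas[OF G] by (intro sets.countable_UN'' Q) measurable
    finally show "{\<omega> \<in> space M. d (F \<omega>) (G \<omega>) < c} \<in> sets M" .
  qed
qed

lemma rate_distortion_le:
  fixes T :: "'a::topological_space \<Rightarrow> 'a" and M :: "'w measure"
  assumes T: "dynamical_system T" and d: "compatible_metric d"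
    and adm: "rate_admissible T d \<mu> \<epsilon> n M X Y"
  shows "rate_distortion T d \<mu> \<epsilon> \<le>
    mutual_info M borel (PiM {..<n} (\<lambda>_. borel)) X Y / ereal (real n)"
proof -
  let ?B = "PiM {..<n} (\<lambda>_. borel :: 'a measure)"
  let ?Z = "\<lambda>\<omega>. (X \<omega>, Y \<omega>)" and ?P = "borel \<Otimes>\<^sub>M ?B"
  let ?D = "\<lambda>x y. (\<Sum>k<n. d ((T ^^ k) x) (y k)) / real n"
  have M: "prob_space M" and X: "X \<in> measurable M borel" and Y: "Y \<in> measurable M ?B"
    using adm by (auto simp: rate_admissible_def)
  have Z: "?Z \<in> measurable M ?P" using X Y by measurable
  have cont: "continuous_on UNIV T"
    using T by (auto simp: dynamical_system_def dest!: homeomorphic_imp_continuous_map)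
  have mT: "T ^^ k \<in> measurable borel borel" for k
  proof (induction k)
    case (Suc k)
    then show ?case
      using measurable_comp[OF Suc borel_measurable_continuous_onI[OF cont]] by (simp add: comp_def)
  qed (simp add: id_def)
  have D: "(\<lambda>\<omega>. ?D (fst \<omega>) (snd \<omega>)) \<in> borel_measurable ?P"
  proof (intro borel_measurable_divide borel_measurable_sum borel_measurable_const)
    fix k assume k: "k \<in> {..<n}"
    show "(\<lambda>\<omega>. d ((T ^^ k) (fst \<omega>)) (snd \<omega> k)) \<in> borel_measurable ?P"
    proof (rule measurable_compatible_metric[OF d])
      show "compact (UNIV :: 'a set)" using T by (simp add: dynamical_system_def)
      show "(\<lambda>\<omega>. (T ^^ k) (fst \<omega>)) \<in> measurable ?P borel"
        using measurable_comp[OF measurable_fst mT] by (simp add: comp_def)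
      show "(\<lambda>\<omega>. snd \<omega> k) \<in> measurable ?P borel"
        using measurable_comp[OF measurable_snd measurable_component_singleton[OF k]]
        by (simp add: comp_def)
    qed
  qed
  have "rate_admissible T d \<mu> \<epsilon> n (distr M ?P ?Z) fst snd"
    using adm prob_space.prob_space_distr[OF M Z] integral_distr[OF Z D] distr_distr[OF measurable_fst Z]
    by (auto simp: rate_admissible_def comp_def)
  then show ?thesis
    unfolding rate_distortion_def mutual_info_distr[OF M X Y, symmetric]
    by (intro Inf_lower) blast
qed

end

theory Submission
  imports Defs
begin

text \<open>For a fixed scale \<open>\<epsilon> < 1\<close>, an open cover \<open>U\<^sub>1, \<dots>, U\<^sub>n\<close> with \<open>d\<^sub>N\<close>-diameters below \<open>\<epsilon>\<close> is a
  lossy code for orbit segments of length \<open>N\<close>: replace \<open>x\<close> by the index of a cover member that contains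
  it, and decode an index as the orbit of a chosen point of that member. The distortion is below
  \<open>\<epsilon>\<close>, and the mutual information is at most the entropy of the measurable partition \<open>A\<^sub>1, \<dots>, A\<^sub>n\<close>
  that the indices define. The Gibbs variational inequality bounds entropy plus energy by
  \<open>- \<Sum> \<mu>(A\<^sub>i) ln \<mu>(A\<^sub>i) + ln (1/\<epsilon>) \<Sum> \<mu>(A\<^sub>i) sup \<phi>\<^sub>N(U\<^sub>i) \<le> ln \<Sum> (1/\<epsilon>)\<^bsup>sup \<phi>\<^sub>N(U\<^sub>i)\<^esup>\<close>.
  The sum \<open>\<Sum> \<mu>(A\<^sub>i) sup \<phi>\<^sub>N(U\<^sub>i)\<close> dominates \<open>\<integral> \<phi>\<^sub>N d\<mu>\<close>, which is at least \<open>N\<close> times the mean of the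
  potential, by Fekete's lemma. Dividing by \<open>N\<close>, taking the infimum over the covers and then over \<open>N\<close> gives
  \<open>R(\<epsilon>) + ln (1/\<epsilon>) F\<^sub>* \<le> P(\<epsilon>)\<close> (\<open>rate_distortion_add_mean_le_pressure\<close>). The limit that defines
  \<open>P(\<epsilon>)\<close> exists and equals this infimum, because refining a cover by a pulled back cover makes
  the covering sums submultiplicative (\<open>pressure_eq_INF\<close>). Both inequalities of the theorem follow after
  division by \<open>ln (1/\<epsilon>)\<close>, since a finite constant passes through \<open>Limsup\<close> and \<open>Liminf\<close>.\<close>

section \<open>Fekete's lemma and the Gibbs inequality\<close>

text \<open>The sequence \<open>a n - n c\<close> with \<open>c = a m / m\<close> is still subadditive and vanishes at \<open>m\<close>; hence it
  is bounded by its values on one period \<open>1, \<dots>, m\<close>, so \<open>a n / n \<le> c + K / n\<close>. Stated in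
  \<^typ>\<open>ereal\<close> because the infimum may be \<open>-\<infinity>\<close>.\<close>

lemma fekete:
  fixes a :: "nat \<Rightarrow> real"
  assumes sub: "\<And>m n. 1 \<le> m \<Longrightarrow> 1 \<le> n \<Longrightarrow> a (m + n) \<le> a m + a n"
  shows "(\<lambda>n. ereal (a n / real n)) \<longlonglongrightarrow> (INF n\<in>{1..}. ereal (a n / real n))"
proof (rule order_tendstoI)
  fix y assume "y < (INF n\<in>{1..}. ereal (a n / real n))"
  then have "y < ereal (a n / real n)" if "1 \<le> n" for n
    using that by (auto dest: less_INF_D)
  then show "\<forall>\<^sub>F n in sequentially. y < ereal (a n / real n)"
    unfolding eventually_sequentially by blast
next
  fix y assume "(INF n\<in>{1..}. ereal (a n / real n)) < y"
  then obtain m where m: "1 \<le> m" "ereal (a m / real m) < y"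
    by (auto simp: INF_less_iff)
  define c where "c = a m / real m"
  define b where "b n = a n - real n * c" for n
  define K where "K = (MAX r\<in>{1..m}. b r)"
  have bm: "b m = 0" using m(1) by (simp add: b_def c_def)
  have bsub: "b (k + l) \<le> b k + b l" if "1 \<le> k" "1 \<le> l" for k l
    using sub[OF that] by (simp add: b_def algebra_simps)
  have "b (q * m + r) \<le> K" if "r \<in> {1..m}" for q r
  proof (induction q)
    case 0
    show ?case using that by (simp add: K_def)
  next
    case (Suc q)
    have "b (m + (q * m + r)) \<le> b m + b (q * m + r)" using m(1) that by (intro bsub) auto
    then show ?case using Suc bm by (simp add: add.assoc)
  qed
  (* remainders run over 1, ..., m, because a 0 is unconstrained; hence the division of n - 1 *)
  moreover have "\<exists>q. \<exists>r\<in>{1..m}. n = q * m + r" if n: "1 \<le> n" for n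
  proof (intro exI bexI)
    show "n = ((n - 1) div m) * m + ((n - 1) mod m + 1)" using n by simp
    show "(n - 1) mod m + 1 \<in> {1..m}" using m(1) by (simp add: Suc_le_eq)
  qed
  ultimately have bK: "b n \<le> K" if "1 \<le> n" for n using that by metis
  have upper: "a n / real n \<le> c + K / real n" if "1 \<le> n" for n
    using bK[OF that] that by (simp add: b_def field_simps)
  have "(\<lambda>n. ereal (c + K / real n)) \<longlonglongrightarrow> ereal (c + 0)"
    by (intro tendsto_intros lim_const_over_n)
  then have "\<forall>\<^sub>F n in sequentially. ereal (c + K / real n) < y"
    using m(2) by (intro order_tendstoD) (auto simp: c_def)
  then show "\<forall>\<^sub>F n in sequentially. ereal (a n / real n) < y"
    using eventually_ge_at_top[of 1]
  proof eventually_elim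
    case (elim n)
    then show ?case using upper[of n] by (meson ereal_less_eq(3) order.strict_trans1)
  qed
qed

text \<open>Comparing \<open>p\<close> with the Gibbs distribution \<open>w i / S\<close>, this is nonnegativity of relative
  entropy, which comes termwise from \<open>ln x \<le> x - 1\<close>.\<close>

lemma gibbs_inequality:
  fixes p w :: "'i \<Rightarrow> real"
  assumes I: "finite I" and p: "\<And>i. i \<in> I \<Longrightarrow> 0 \<le> p i" "sum p I = 1"
    and w: "\<And>i. i \<in> I \<Longrightarrow> 0 < w i"
  shows "- (\<Sum>i\<in>I. p i * ln (p i)) + (\<Sum>i\<in>I. p i * ln (w i)) \<le> ln (sum w I)"
proof -
  define S where "S = sum w I"
  have "I \<noteq> {}" using p(2) by auto
  then have S: "0 < S" unfolding S_def using I w by (intro sum_pos) auto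
  have "p i * (ln (w i) - ln S - ln (p i)) \<le> w i / S - p i" if i: "i \<in> I" for i
  proof (cases "p i = 0")
    case True
    then show ?thesis using w[OF i] S by simp
  next
    case False
    then have pos: "0 < p i" using p(1)[OF i] by simp
    have "ln (w i) - ln S - ln (p i) = ln (w i / (S * p i))"
      using w[OF i] S pos by (simp add: ln_div ln_mult)
    also have "\<dots> \<le> w i / (S * p i) - 1"
      using w[OF i] S pos by (intro ln_le_minus_one) simp
    finally have "p i * (ln (w i) - ln S - ln (p i)) \<le> p i * (w i / (S * p i) - 1)"
      using pos by (intro mult_left_mono) auto
    also have "\<dots> = w i / S - p i" using pos S by (simp add: field_simps)
    finally show ?thesis .
  qed
  then have "(\<Sum>i\<in>I. p i * (ln (w i) - ln S - ln (p i))) \<le> (\<Sum>i\<in>I. w i / S - p i)"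
    by (rule sum_mono)
  also have "\<dots> = 0"
    using S p(2) by (simp add: sum_subtractf sum_divide_distrib[symmetric] S_def[symmetric])
  finally have "(\<Sum>i\<in>I. p i * ln (w i)) - (\<Sum>i\<in>I. p i * ln S) - (\<Sum>i\<in>I. p i * ln (p i)) \<le> 0"
    by (simp add: right_diff_distrib sum_subtractf)
  moreover have "(\<Sum>i\<in>I. p i * ln S) = ln S"
    using p(2) by (simp add: sum_distrib_right[symmetric])
  ultimately show ?thesis by (simp add: S_def)
qed


section \<open>Mutual information with a deterministic code\<close>

lemma shannon_entropy_comp_le:
  assumes "prob_space M" "simple_function M X"
  shows "shannon_entropy M (h \<circ> X) \<le> shannon_entropy M X"
proof -
  interpret information_space M "exp 1"
    using assms(1) by (simp add: information_space_def information_space_axioms_def)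
  show ?thesis
    unfolding shannon_entropy_def by (rule entropy_data_processing[OF assms(2)])
qed

text \<open>For quantizers \<open>f\<close> and \<open>g\<close> the two data-processing bounds \<open>H(f X) \<le> H(f X, g Y)\<close> and
  \<open>H(g Y) \<le> H(J)\<close> add up to \<open>I(f X; g Y) \<le> H(J)\<close>.\<close>

lemma mutual_info_le_entropy:
  fixes X :: "'w \<Rightarrow> 'b" and Y :: "'w \<Rightarrow> 'c" and J :: "'w \<Rightarrow> 'j"
  assumes M: "prob_space M" and X: "X \<in> measurable M S"
    and J: "simple_function M J" and Y: "\<And>\<omega>. Y \<omega> = h (J \<omega>)"
  shows "mutual_info M S S' X Y \<le> ereal (shannon_entropy M J)"
  unfolding mutual_info_def
proof (rule Sup_least, clarify)
  fix f :: "'b \<Rightarrow> nat" and g :: "'c \<Rightarrow> nat"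
  assume f: "f \<in> measurable S (count_space UNIV)" "finite (f ` space S)"
  have "(f \<circ> X) ` space M \<subseteq> f ` space S" using measurable_space[OF X] by auto
  then have "finite ((f \<circ> X) ` space M)" using f(2) finite_subset by blast
  then have sX: "simple_function M (f \<circ> X)"
    unfolding simple_function_def using measurable_sets[OF measurable_comp[OF X f(1)]] by auto
  have gY: "g \<circ> Y = (g \<circ> h) \<circ> J" using Y by auto
  have sY: "simple_function M (g \<circ> Y)"
    unfolding gY by (rule simple_function_compose[OF J])
  have "shannon_entropy M (g \<circ> Y) \<le> shannon_entropy M J"
    unfolding gY by (rule shannon_entropy_comp_le[OF M J])
  moreover have "shannon_entropy M (fst \<circ> (\<lambda>\<omega>. (f (X \<omega>), g (Y \<omega>))))
      \<le> shannon_entropy M (\<lambda>\<omega>. (f (X \<omega>), g (Y \<omega>)))"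
    using simple_function_Pair[OF sX sY] by (intro shannon_entropy_comp_le M) (simp add: comp_def)
  ultimately show "ereal (shannon_entropy M (f \<circ> X) + shannon_entropy M (g \<circ> Y)
      - shannon_entropy M (\<lambda>\<omega>. (f (X \<omega>), g (Y \<omega>)))) \<le> ereal (shannon_entropy M J)"
    by (simp add: comp_def)
qed


section \<open>Covering sums and pressure\<close>

text \<open>Re-indexing lets covers by arbitrary finite index sets compete in the infimum; this is what
  the refinement of two covers, indexed by pairs, requires.\<close>

lemma covering_sum_le:
  fixes U :: "'i \<Rightarrow> 'a::topological_space set"
  assumes I: "finite I" and cov: "(\<Union>i\<in>I. U i) = UNIV"
    and U: "\<And>i. i \<in> I \<Longrightarrow> open (U i) \<and> U i \<noteq> {} \<and> diam D (U i) < \<epsilon>"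
  shows "covering_sum D \<phi> \<epsilon> \<le> (\<Sum>i\<in>I. (1 / \<epsilon>) powr (SUP x\<in>U i. \<phi> x))"
proof -
  obtain h where h: "bij_betw h {..<card I} I"
    using ex_bij_betw_nat_finite[OF I] by (auto simp: atLeast0LessThan)
  have img: "h ` {..<card I} = I" using h by (simp add: bij_betw_def)
  show ?thesis
    unfolding covering_sum_def
  proof (rule cInf_lower)
    show "bdd_below {\<Sum>i<n. (1 / \<epsilon>) powr (SUP x\<in>U i. \<phi> x) | (n :: nat) (U :: nat \<Rightarrow> 'a set).
        (\<Union>i<n. U i) = UNIV \<and> (\<forall>i<n. open (U i) \<and> U i \<noteq> {} \<and> diam D (U i) < \<epsilon>)}"
      by (intro bdd_belowI[of _ 0]) (auto intro!: sum_nonneg)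
    have "(\<Sum>i\<in>I. (1 / \<epsilon>) powr (SUP x\<in>U i. \<phi> x))
        = (\<Sum>k<card I. (1 / \<epsilon>) powr (SUP x\<in>(U \<circ> h) k. \<phi> x))"
      using sum.reindex_bij_betw[OF h, of "\<lambda>i. (1 / \<epsilon>) powr (SUP x\<in>U i. \<phi> x)"] by simp
    moreover have "(\<Union>k<card I. (U \<circ> h) k) = UNIV"
      using cov img by (metis image_comp)
    moreover have "\<forall>k<card I. open ((U \<circ> h) k) \<and> (U \<circ> h) k \<noteq> {} \<and> diam D ((U \<circ> h) k) < \<epsilon>"
      using U img by auto
    ultimately show "(\<Sum>i\<in>I. (1 / \<epsilon>) powr (SUP x\<in>U i. \<phi> x)) \<in>
      {\<Sum>i<n. (1 / \<epsilon>) powr (SUP x\<in>U i. \<phi> x) | (n :: nat) (U :: nat \<Rightarrow> 'a set).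
        (\<Union>i<n. U i) = UNIV \<and> (\<forall>i<n. open (U i) \<and> U i \<noteq> {} \<and> diam D (U i) < \<epsilon>)}"
      by blast
  qed
qed

locale subadditive_system =
  fixes T :: "'a::topological_space \<Rightarrow> 'a" and d :: "'a \<Rightarrow> 'a \<Rightarrow> real" and \<phi> :: "nat \<Rightarrow> 'a \<Rightarrow> real"
  assumes system: "dynamical_system T" and metric: "compatible_metric d"
    and potential: "subadditive_potential T \<phi>"
begin

sublocale Metric_space UNIV d
  using metric by (simp add: compatible_metric_def)

lemma compact_space: "compact (UNIV :: 'a set)"
  using system by (simp add: dynamical_system_def)

lemma continuous_orbit: "continuous_on UNIV (T ^^ k)"
proof (induction k)
  case (Suc k)
  have "continuous_on UNIV T"
    using system by (auto simp: dynamical_system_def dest!: homeomorphic_imp_continuous_map)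
  then have "continuous_on UNIV (\<lambda>x. T ((T ^^ k) x))"
    by (rule continuous_on_compose2[OF _ Suc]) simp
  then show ?case by (simp add: comp_def)
qed (simp add: id_def)

lemma continuous_potential: "1 \<le> N \<Longrightarrow> continuous_on UNIV (\<phi> N)"
  using potential by (simp add: subadditive_potential_def)

lemma potential_add_le:
  "1 \<le> N \<Longrightarrow> 1 \<le> M \<Longrightarrow> \<phi> (N + M) x \<le> \<phi> N x + \<phi> M ((T ^^ N) x)"
  using potential by (simp add: subadditive_potential_def)

lemma potential_bounded:
  assumes "1 \<le> N" obtains B where "\<And>x. \<bar>\<phi> N x\<bar> \<le> B"
proof -
  have "bounded (range (\<phi> N))"
    using compact_continuous_image[OF continuous_potential[OF assms] compact_space]
    by (rule compact_imp_bounded)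
  then show ?thesis using that by (auto simp: bounded_iff)
qed

lemma bdd_above_potential: "1 \<le> N \<Longrightarrow> bdd_above (\<phi> N ` U)"
  by (metis abs_le_D1 bdd_aboveI2 potential_bounded)

lemma metric_bounded: obtains B where "\<And>x y. d x y \<le> B"
proof -
  have "mbounded UNIV"
    using compact_space metric
    by (intro compactin_imp_mbounded) (simp add: compatible_metric_def compactin_euclidean_iff)
  then show ?thesis using that unfolding mbounded_alt by blast
qed

lemma dyn_metric_le_iff:
  "1 \<le> N \<Longrightarrow> dyn_metric T d N x y \<le> e \<longleftrightarrow> (\<forall>k<N. d ((T ^^ k) x) ((T ^^ k) y) \<le> e)"
  unfolding dyn_metric_def by (subst Max_le_iff) (auto simp: lessThan_empty_iff)

lemma dist_orbit_le_diam:
  assumes "k < N" "x \<in> U" "y \<in> U"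
  shows "d ((T ^^ k) x) ((T ^^ k) y) \<le> diam (dyn_metric T d N) U"
proof -
  have N: "1 \<le> N" using assms(1) by simp
  obtain B where B: "\<And>x y. d x y \<le> B" using metric_bounded by blast
  have "dyn_metric T d N x y \<le> diam (dyn_metric T d N) U"
    unfolding diam_def
  proof (rule cSUP_upper2[where x = "(x, y)"])
    show "bdd_above ((\<lambda>(x, y). dyn_metric T d N x y) ` (U \<times> U))"
      using B N by (intro bdd_aboveI2[where M = B]) (auto simp: dyn_metric_le_iff)
  qed (use assms in auto)
  then show ?thesis using assms(1) N by (simp add: dyn_metric_le_iff)
qed

lemma diam_dyn_metric_le:
  assumes "1 \<le> N" "U \<noteq> {}"
    and "\<And>x y k. x \<in> U \<Longrightarrow> y \<in> U \<Longrightarrow> k < N \<Longrightarrow> d ((T ^^ k) x) ((T ^^ k) y) \<le> e"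
  shows "diam (dyn_metric T d N) U \<le> e"
  unfolding diam_def using assms by (intro cSUP_least) (auto simp: dyn_metric_le_iff)

abbreviation fine_cover :: "nat \<Rightarrow> real \<Rightarrow> nat \<Rightarrow> (nat \<Rightarrow> 'a set) \<Rightarrow> bool" where
  "fine_cover N \<epsilon> n U \<equiv> (\<Union>i<n. U i) = UNIV \<and>
     (\<forall>i<n. open (U i) \<and> U i \<noteq> {} \<and> diam (dyn_metric T d N) (U i) < \<epsilon>)"

abbreviation cover_sum :: "nat \<Rightarrow> real \<Rightarrow> nat \<Rightarrow> (nat \<Rightarrow> 'a set) \<Rightarrow> real" where
  "cover_sum N \<epsilon> n U \<equiv> (\<Sum>i<n. (1 / \<epsilon>) powr (SUP x\<in>U i. \<phi> N x))"

abbreviation cs :: "nat \<Rightarrow> real \<Rightarrow> real" where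
  "cs N \<epsilon> \<equiv> covering_sum (dyn_metric T d N) (\<phi> N) \<epsilon>"

text \<open>Finitely many Bowen balls of radius \<open>\<epsilon>/3\<close> suffice, by compactness; their diameters are at most
  \<open>2\<epsilon>/3\<close>. Without a fine cover the covering sum would be the infimum of the empty set.\<close>

lemma fine_cover_exists:
  assumes N: "1 \<le> N" and \<epsilon>: "0 < \<epsilon>"
  obtains n U where "fine_cover N \<epsilon> n U"
proof -
  define B where "B x = (\<Inter>k<N. (T ^^ k) -` mball ((T ^^ k) x) (\<epsilon> / 3))" for x
  have ball: "open (mball q r)" for q r
    using openin_mball[of q r] metric unfolding compatible_metric_def by (simp only: open_openin)
  have op: "open (B x)" for x
    unfolding B_def using continuous_orbit ball by (intro open_INT) (auto intro: open_vimage)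
  have self: "x \<in> B x" for x using \<epsilon> by (auto simp: B_def)
  have "UNIV \<subseteq> (\<Union>x\<in>UNIV. B x)" using self by blast
  from compactE_image[OF compact_space op this] obtain K
    where K: "finite K" "UNIV \<subseteq> (\<Union>x\<in>K. B x)" by metis
  obtain h where h: "bij_betw h {..<card K} K"
    using ex_bij_betw_nat_finite[OF K(1)] by (auto simp: atLeast0LessThan)
  have "diam (dyn_metric T d N) (B x) \<le> 2 * \<epsilon> / 3" for x
  proof (rule diam_dyn_metric_le[OF N])
    show "B x \<noteq> {}" using self by blast
    fix y z k assume *: "y \<in> B x" "z \<in> B x" "k < N"
    then have "d ((T ^^ k) x) ((T ^^ k) y) < \<epsilon> / 3" "d ((T ^^ k) x) ((T ^^ k) z) < \<epsilon> / 3"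
      by (auto simp: B_def)
    then show "d ((T ^^ k) y) ((T ^^ k) z) \<le> 2 * \<epsilon> / 3"
      using triangle[of "(T ^^ k) y" "(T ^^ k) x" "(T ^^ k) z"]
      by (simp add: commute[of "(T ^^ k) y" "(T ^^ k) x"])
  qed
  moreover have "2 * \<epsilon> / 3 < \<epsilon>" using \<epsilon> by simp
  ultimately have "diam (dyn_metric T d N) (B x) < \<epsilon>" for x
    by (meson order.strict_trans1)
  moreover have "(\<Union>i<card K. (B \<circ> h) i) = UNIV"
    using K(2) h unfolding bij_betw_def by (metis image_comp top.extremum_uniqueI)
  ultimately show ?thesis
    using op self by (intro that[of "B \<circ> h" "card K"]) (simp, metis empty_iff)
qed

lemma cover_sum_ge: "fine_cover N \<epsilon> n U \<Longrightarrow> cs N \<epsilon> \<le> cover_sum N \<epsilon> n U"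
  by (rule covering_sum_le) auto

lemma covering_sum_greatest:
  assumes "1 \<le> N" "0 < \<epsilon>" and "\<And>n U. fine_cover N \<epsilon> n U \<Longrightarrow> c \<le> cover_sum N \<epsilon> n U"
  shows "c \<le> cs N \<epsilon>"
  unfolding covering_sum_def
proof (rule cInf_greatest)
  show "{cover_sum N \<epsilon> n U | n U. fine_cover N \<epsilon> n U} \<noteq> {}"
  proof -
    obtain n U where "fine_cover N \<epsilon> n U" by (rule fine_cover_exists[OF assms(1,2)])
    then have "cover_sum N \<epsilon> n U \<in> {cover_sum N \<epsilon> n U | n U. fine_cover N \<epsilon> n U}"
      by (intro CollectI exI conjI) auto
    then show ?thesis by (metis empty_iff)
  qed
  show "c \<le> s" if "s \<in> {cover_sum N \<epsilon> n U | n U. fine_cover N \<epsilon> n U}" for s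
    using that by (clarify, intro assms(3) conjI)
qed

lemma covering_sum_pos:
  assumes N: "1 \<le> N" and \<epsilon>: "0 < \<epsilon>" "\<epsilon> < 1"
  shows "0 < cs N \<epsilon>"
proof -
  obtain B where B: "\<And>x. \<bar>\<phi> N x\<bar> \<le> B" using potential_bounded[OF N] by blast
  have "(1 / \<epsilon>) powr (- B) \<le> cs N \<epsilon>"
  proof (rule covering_sum_greatest[OF N \<epsilon>(1)])
    fix n U assume U: "fine_cover N \<epsilon> n U"
    then have n: "0 < n" by (cases n) auto
    with U obtain x where x: "x \<in> U 0" by auto
    have "- B \<le> \<phi> N x" using B[of x] by simp
    also have "\<dots> \<le> (SUP x\<in>U 0. \<phi> N x)" by (intro cSUP_upper x bdd_above_potential N)
    finally have "(1 / \<epsilon>) powr (- B) \<le> (1 / \<epsilon>) powr (SUP x\<in>U 0. \<phi> N x)"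
      using \<epsilon> by (intro powr_mono) auto
    also have "\<dots> \<le> cover_sum N \<epsilon> n U"
      using n by (intro member_le_sum) auto
    finally show "(1 / \<epsilon>) powr (- B) \<le> cover_sum N \<epsilon> n U" .
  qed
  moreover have "0 < (1 / \<epsilon>) powr (- B)" using \<epsilon>(1) by simp
  ultimately show ?thesis by linarith
qed

text \<open>The refinement of a \<open>d\<^sub>N\<close>-fine cover \<open>U\<close> by the pullback under \<open>T^N\<close> of a \<open>d\<^sub>M\<close>-fine cover \<open>V\<close>
  is \<open>d\<^bsub>N+M\<^esub>\<close>-fine, and by subadditivity each of its terms is at most a product of a term of \<open>U\<close> and a term
  of \<open>V\<close>. The base \<open>1/\<epsilon>\<close> must be at least 1 for this monotonicity.\<close>

lemma covering_sum_submult: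
  assumes N: "1 \<le> N" and M: "1 \<le> M" and \<epsilon>: "0 < \<epsilon>" "\<epsilon> < 1"
  shows "cs (N + M) \<epsilon> \<le> cs N \<epsilon> * cs M \<epsilon>"
proof -
  have refine: "cs (N + M) \<epsilon> \<le> cover_sum N \<epsilon> n U * cover_sum M \<epsilon> m V"
    if U: "fine_cover N \<epsilon> n U" and V: "fine_cover M \<epsilon> m V" for n U m V
  proof -
    define W where "W = (\<lambda>(i, j). U i \<inter> (T ^^ N) -` V j)"
    define I where "I = {(i, j) \<in> {..<n} \<times> {..<m}. W (i, j) \<noteq> {}}"
    have fin: "finite I" unfolding I_def by (rule finite_subset[of _ "{..<n} \<times> {..<m}"]) auto
    have NM: "1 \<le> N + M" using N by simp
    have "cs (N + M) \<epsilon> \<le> (\<Sum>p\<in>I. (1 / \<epsilon>) powr (SUP x\<in>W p. \<phi> (N + M) x))"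
    proof (rule covering_sum_le[OF fin])
      have "\<exists>p\<in>I. x \<in> W p" for x
      proof -
        have "x \<in> (\<Union>i<n. U i)" "(T ^^ N) x \<in> (\<Union>j<m. V j)" using U V by (simp_all only: UNIV_I)
        then obtain i j where "i < n" "x \<in> U i" "j < m" "(T ^^ N) x \<in> V j" by blast
        then show ?thesis by (intro bexI[of _ "(i, j)"]) (auto simp: I_def W_def)
      qed
      then show "(\<Union>p\<in>I. W p) = UNIV" by blast
      fix p assume "p \<in> I"
      then obtain i j where p: "p = (i, j)" "i < n" "j < m" "W p \<noteq> {}" by (auto simp: I_def)
      let ?e = "max (diam (dyn_metric T d N) (U i)) (diam (dyn_metric T d M) (V j))"
      have "diam (dyn_metric T d (N + M)) (W p) \<le> ?e"
      proof (rule diam_dyn_metric_le[OF NM p(4)])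
        fix x y k assume *: "x \<in> W p" "y \<in> W p" "k < N + M"
        show "d ((T ^^ k) x) ((T ^^ k) y) \<le> ?e"
        proof (cases "k < N")
          case True
          then show ?thesis using dist_orbit_le_diam[of k N x "U i" y] * p by (auto simp: W_def)
        next
          case False
          then have k: "k = (k - N) + N" by simp
          have orb: "(T ^^ k) z = (T ^^ (k - N)) ((T ^^ N) z)" for z
            by (subst k) (simp only: funpow_add comp_def)
          have "k - N < M" using *(3) False by simp
          moreover have "(T ^^ N) x \<in> V j" "(T ^^ N) y \<in> V j" using * p by (auto simp: W_def)
          ultimately show ?thesis
            unfolding orb by (intro max.coboundedI2 dist_orbit_le_diam)
        qed
      qed
      moreover have Ui: "open (U i)" "diam (dyn_metric T d N) (U i) < \<epsilon>"
        and Vj: "open (V j)" "diam (dyn_metric T d M) (V j) < \<epsilon>"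
        using U V p(2,3) by blast+
      moreover have "open (W p)"
        unfolding W_def p(1) prod.case by (intro open_Int open_vimage Ui Vj continuous_orbit)
      ultimately show "open (W p) \<and> W p \<noteq> {} \<and> diam (dyn_metric T d (N + M)) (W p) < \<epsilon>"
        using p(4) by linarith
    qed
    also have "\<dots> \<le> (\<Sum>(i, j)\<in>I. (1 / \<epsilon>) powr (SUP x\<in>U i. \<phi> N x) * (1 / \<epsilon>) powr (SUP x\<in>V j. \<phi> M x))"
    proof (rule sum_mono, clarify)
      fix i j assume ij: "(i, j) \<in> I"
      have "(SUP x\<in>W (i, j). \<phi> (N + M) x) \<le> (SUP x\<in>U i. \<phi> N x) + (SUP x\<in>V j. \<phi> M x)"
      proof (rule cSUP_least)
        show "W (i, j) \<noteq> {}" using ij by (simp add: I_def)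
        fix x assume x: "x \<in> W (i, j)"
        have "\<phi> N x \<le> (SUP x\<in>U i. \<phi> N x)"
          using x by (intro cSUP_upper bdd_above_potential N) (auto simp: W_def)
        moreover have "\<phi> M ((T ^^ N) x) \<le> (SUP x\<in>V j. \<phi> M x)"
          using x by (intro cSUP_upper bdd_above_potential M) (auto simp: W_def)
        ultimately show "\<phi> (N + M) x \<le> (SUP x\<in>U i. \<phi> N x) + (SUP x\<in>V j. \<phi> M x)"
          using potential_add_le[OF N M, of x] by linarith
      qed
      then have "(1 / \<epsilon>) powr (SUP x\<in>W (i, j). \<phi> (N + M) x)
          \<le> (1 / \<epsilon>) powr ((SUP x\<in>U i. \<phi> N x) + (SUP x\<in>V j. \<phi> M x))"
        using \<epsilon> by (intro powr_mono) auto
      then show "(1 / \<epsilon>) powr (SUP x\<in>W (i, j). \<phi> (N + M) x)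
          \<le> (1 / \<epsilon>) powr (SUP x\<in>U i. \<phi> N x) * (1 / \<epsilon>) powr (SUP x\<in>V j. \<phi> M x)"
        by (simp add: powr_add)
    qed
    also have "\<dots> \<le> (\<Sum>(i, j)\<in>{..<n} \<times> {..<m}.
        (1 / \<epsilon>) powr (SUP x\<in>U i. \<phi> N x) * (1 / \<epsilon>) powr (SUP x\<in>V j. \<phi> M x))"
      by (rule sum_mono2) (auto simp: I_def)
    also have "\<dots> = cover_sum N \<epsilon> n U * cover_sum M \<epsilon> m V"
      by (simp add: sum_product sum.cartesian_product)
    finally show ?thesis .
  qed
  have half: "cs (N + M) \<epsilon> / cs N \<epsilon> \<le> cover_sum M \<epsilon> m V" if V: "fine_cover M \<epsilon> m V" for m V
  proof -
    have s: "0 < cover_sum M \<epsilon> m V"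
      using covering_sum_pos[OF M \<epsilon>] cover_sum_ge[OF V] by linarith
    have "cs (N + M) \<epsilon> / cover_sum M \<epsilon> m V \<le> cs N \<epsilon>"
    proof (rule covering_sum_greatest[OF N \<epsilon>(1)])
      fix n U assume "fine_cover N \<epsilon> n U"
      from refine[OF this V] show "cs (N + M) \<epsilon> / cover_sum M \<epsilon> m V \<le> cover_sum N \<epsilon> n U"
        using s by (simp only: pos_divide_le_eq)
    qed
    then show ?thesis
      using s covering_sum_pos[OF N \<epsilon>] by (simp only: pos_divide_le_eq mult.commute)
  qed
  have "cs (N + M) \<epsilon> / cs N \<epsilon> \<le> cs M \<epsilon>"
    by (rule covering_sum_greatest[OF M \<epsilon>(1) half])
  then show ?thesis
    using covering_sum_pos[OF N \<epsilon>] by (simp only: pos_divide_le_eq mult.commute)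
qed

lemma pressure_eq_INF:
  assumes \<epsilon>: "0 < \<epsilon>" "\<epsilon> < 1"
  shows "pressure T d \<phi> \<epsilon> = (INF N\<in>{1..}. ereal (ln (cs N \<epsilon>) / real N))"
  unfolding pressure_def
proof (intro limI fekete)
  fix N M :: nat assume NM: "1 \<le> N" "1 \<le> M"
  have "ln (cs (N + M) \<epsilon>) \<le> ln (cs N \<epsilon> * cs M \<epsilon>)"
    using covering_sum_submult[OF NM \<epsilon>] covering_sum_pos[OF _ \<epsilon>, of "N + M"] NM
    by (intro ln_mono) auto
  then show "ln (cs (N + M) \<epsilon>) \<le> ln (cs N \<epsilon>) + ln (cs M \<epsilon>)"
    using covering_sum_pos[OF NM(1) \<epsilon>] covering_sum_pos[OF NM(2) \<epsilon>] by (simp add: ln_mult)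
qed

end


section \<open>Coding an invariant measure by a cover\<close>

locale invariant_subadditive_system = subadditive_system T d \<phi>
  for T :: "'a::topological_space \<Rightarrow> 'a" and d \<phi> +
  fixes \<mu> :: "'a measure"
  assumes invariant: "invariant_probability T \<mu>"
begin

sublocale prob_space \<mu>
  using invariant by (simp add: invariant_probability_def)

lemma sets_mu: "sets \<mu> = sets borel"
  using invariant by (simp add: invariant_probability_def)

lemma space_mu: "space \<mu> = UNIV"
  using sets_eq_imp_space_eq[OF sets_mu] by simp

lemma measurable_orbit: "T ^^ k \<in> measurable borel borel"
  by (rule borel_measurable_continuous_onI[OF continuous_orbit])

lemma measurable_potential: "1 \<le> N \<Longrightarrow> \<phi> N \<in> borel_measurable borel"
  by (rule borel_measurable_continuous_onI[OF continuous_potential])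

lemma distr_orbit: "distr \<mu> borel (T ^^ k) = \<mu>"
proof (induction k)
  case 0
  show ?case using distr_id2[OF sets_mu[symmetric]] by (simp add: id_def)
next
  case (Suc k)
  have T: "T \<in> measurable borel borel" using measurable_orbit[of 1] by simp
  have "distr \<mu> borel (T ^^ Suc k) = distr (distr \<mu> borel (T ^^ k)) borel T"
    using T measurable_orbit[of k] sets_mu
    by (subst distr_distr) (auto simp: comp_def cong: measurable_cong_sets)
  then show ?case using Suc invariant by (simp only: invariant_probability_def)
qed

lemma integrable_potential: "1 \<le> N \<Longrightarrow> integrable \<mu> (\<phi> N)"
proof -
  assume N: "1 \<le> N"
  then obtain B where "\<And>x. \<bar>\<phi> N x\<bar> \<le> B" using potential_bounded by blast
  then show ?thesis
    using measurable_potential[OF N] sets_mu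
    by (intro integrable_const_bound[where B = B]) (auto cong: measurable_cong_sets)
qed

lemma integral_potential_orbit:
  assumes "1 \<le> M"
  shows "integrable \<mu> (\<lambda>x. \<phi> M ((T ^^ N) x))" "(\<integral>x. \<phi> M ((T ^^ N) x) \<partial>\<mu>) = (\<integral>x. \<phi> M x \<partial>\<mu>)"
proof -
  have "T ^^ N \<in> measurable \<mu> borel"
    using measurable_orbit sets_mu by (simp cong: measurable_cong_sets)
  then show "integrable \<mu> (\<lambda>x. \<phi> M ((T ^^ N) x))" "(\<integral>x. \<phi> M ((T ^^ N) x) \<partial>\<mu>) = (\<integral>x. \<phi> M x \<partial>\<mu>)"
    using integrable_potential[OF assms] integrable_distr_eq[of "T ^^ N" \<mu> borel "\<phi> M"]
      integral_distr[of "T ^^ N" \<mu> borel "\<phi> M"] measurable_potential[OF assms]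
    unfolding distr_orbit by auto
qed

lemma potential_mean_eq_INF:
  "potential_mean \<phi> \<mu> = (INF n\<in>{1..}. ereal ((\<integral>x. \<phi> n x \<partial>\<mu>) / real n))"
  unfolding potential_mean_def
proof (intro limI fekete)
  fix N M :: nat assume NM: "1 \<le> N" "1 \<le> M"
  have "(\<integral>x. \<phi> (N + M) x \<partial>\<mu>) \<le> (\<integral>x. \<phi> N x + \<phi> M ((T ^^ N) x) \<partial>\<mu>)"
    using NM integrable_potential integral_potential_orbit(1) potential_add_le
    by (intro integral_mono Bochner_Integration.integrable_add) auto
  also have "\<dots> = (\<integral>x. \<phi> N x \<partial>\<mu>) + (\<integral>x. \<phi> M x \<partial>\<mu>)"
    using NM integrable_potential integral_potential_orbit by simp
  finally show "(\<integral>x. \<phi> (N + M) x \<partial>\<mu>) \<le> (\<integral>x. \<phi> N x \<partial>\<mu>) + (\<integral>x. \<phi> M x \<partial>\<mu>)" .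
qed

lemma potential_mean_le: "1 \<le> N \<Longrightarrow> potential_mean \<phi> \<mu> \<le> ereal ((\<integral>x. \<phi> N x \<partial>\<mu>) / real N)"
  unfolding potential_mean_eq_INF by (intro INF_lower) simp

lemma simple_function_cover_index:
  fixes J :: "'a \<Rightarrow> nat"
  assumes U: "\<And>i. i < n \<Longrightarrow> open (U i)" "(\<Union>i<n. U i) = UNIV"
    and J: "J = (\<lambda>x. LEAST i. x \<in> U i)"
  shows "J x < n" "x \<in> U (J x)" "simple_function \<mu> J"
proof -
  have ex: "\<exists>i<n. x \<in> U i" for x using U(2) by blast
  show mem: "x \<in> U (J x)" for x using ex[of x] unfolding J by (metis LeastI)
  show lt: "J x < n" for x using ex[of x] unfolding J by (metis Least_le order.strict_trans1)
  have "J -` {i} \<in> sets borel" if i: "i < n" for i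
  proof -
    have "J -` {i} = U i - (\<Union>j<i. U j)"
    proof (intro set_eqI iffI)
      fix x assume "x \<in> J -` {i}"
      then have Jx: "J x = i" by simp
      have "x \<notin> U j" if "j < i" for j
        using not_less_Least[of j "\<lambda>j. x \<in> U j"] that Jx unfolding J by simp
      then show "x \<in> U i - (\<Union>j<i. U j)" using mem[of x] Jx by blast
    next
      fix x assume "x \<in> U i - (\<Union>j<i. U j)"
      then have "x \<in> U i" "\<And>j. x \<in> U j \<Longrightarrow> i \<le> j" by (auto simp: not_less[symmetric])
      then have "(LEAST j. x \<in> U j) = i" by (rule Least_equality)
      then show "x \<in> J -` {i}" by (simp add: J)
    qed
    then show ?thesis using U(1) i by (auto intro!: sets.Diff sets.finite_UN)
  qed
  moreover have "finite (J ` UNIV)" using lt by (auto intro: finite_subset[of _ "{..<n}"])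
  ultimately show "simple_function \<mu> J"
    unfolding simple_function_def space_mu using lt sets_mu by auto
qed

text \<open>The code sends \<open>x\<close> to the index \<open>J x\<close> of the first cover member that contains it and decodes an
  index \<open>i\<close> as the orbit segment of a point of \<open>U i\<close>. Strictness of the distortion bound survives
  integration because there are only finitely many diameters.\<close>

lemma rate_distortion_le_cover_entropy:
  assumes N: "1 \<le> N" and \<epsilon>: "0 < \<epsilon>" and U: "fine_cover N \<epsilon> n U"
    and J: "J = (\<lambda>x. LEAST i. x \<in> U i)"
  shows "rate_distortion T d \<mu> \<epsilon> \<le> ereal (shannon_entropy \<mu> J / real N)"
proof -
  have J_lt: "J x < n" and J_mem: "x \<in> U (J x)" and J_simple: "simple_function \<mu> J" for x
    using simple_function_cover_index[OF _ _ J, of n] U by blast+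
  define p where "p i = (SOME x. x \<in> U i)" for i
  have p: "p i \<in> U i" if "i < n" for i
    using U that unfolding p_def by (metis some_in_eq)
  define h where "h i = restrict (\<lambda>k. (T ^^ k) (p i)) {..<N}" for i
  let ?Y = "\<lambda>x. h (J x)" and ?B = "PiM {..<N} (\<lambda>_. borel :: 'a measure)"
  have "n \<noteq> 0" using J_lt by (metis less_nat_zero_code)
  define \<delta> where "\<delta> = (MAX i\<in>{..<n}. diam (dyn_metric T d N) (U i))"
  have \<delta>: "\<delta> < \<epsilon>"
    unfolding \<delta>_def using U \<open>n \<noteq> 0\<close> by (subst Max_less_iff) auto
  have dist: "(\<Sum>k<N. d ((T ^^ k) x) (?Y x k)) / real N \<le> \<delta>" for x
  proof -
    have "d ((T ^^ k) x) (?Y x k) \<le> \<delta>" if k: "k < N" for k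
    proof -
      have "d ((T ^^ k) x) (?Y x k) \<le> diam (dyn_metric T d N) (U (J x))"
        using k dist_orbit_le_diam[OF k J_mem p[OF J_lt]] by (simp add: h_def)
      also have "\<dots> \<le> \<delta>" unfolding \<delta>_def using J_lt by (intro Max_ge) auto
      finally show ?thesis .
    qed
    then have "(\<Sum>k<N. d ((T ^^ k) x) (?Y x k)) \<le> (\<Sum>k<N. \<delta>)" by (intro sum_mono) auto
    then show ?thesis using N by (simp add: field_simps)
  qed
  have "(\<integral>x. (\<Sum>k<N. d ((T ^^ k) x) (?Y x k)) / real N \<partial>\<mu>) < \<epsilon>"
  proof (cases "integrable \<mu> (\<lambda>x. (\<Sum>k<N. d ((T ^^ k) x) (?Y x k)) / real N)")
    case True
    then show ?thesis using integral_le_const[OF True, of \<delta>] dist \<delta> by auto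
  next
    (* the Bochner integral of a non-integrable function is 0 *)
    case False
    from not_integrable_integral_eq[OF this] show ?thesis using \<epsilon> by (simp only:)
  qed
  moreover have "J \<in> measurable \<mu> (count_space UNIV)"
    using J_simple by (rule measurable_simple_function)
  then have "?Y \<in> measurable \<mu> ?B"
    by (rule measurable_compose) (simp add: h_def space_PiM PiE_def extensional_def)
  ultimately have "rate_admissible T d \<mu> \<epsilon> N \<mu> (\<lambda>x. x) ?Y"
    unfolding rate_admissible_def using N prob_space_axioms sets_mu distr_id2[OF sets_mu[symmetric]] by auto
  then have "rate_distortion T d \<mu> \<epsilon> \<le> mutual_info \<mu> borel ?B (\<lambda>x. x) ?Y / ereal (real N)"
    by (rule rate_distortion_le[OF system metric])
  also have "\<dots> \<le> ereal (shannon_entropy \<mu> J) / ereal (real N)"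
    using N sets_mu
    by (intro ereal_divide_right_mono mutual_info_le_entropy[OF prob_space_axioms _ J_simple]) auto
  finally show ?thesis using N by simp
qed

text \<open>The Gibbs inequality for the partition \<open>A\<^sub>i = J\<^sup>-\<^sup>1(i) \<subseteq> U i\<close> with the weights
  \<open>(1/\<epsilon>)\<^bsup>sup \<phi>\<^sub>N(U i)\<^esup>\<close>, whose logarithms are \<open>ln (1/\<epsilon>)\<close> times upper bounds of \<open>\<phi>\<^sub>N\<close> on the \<open>A\<^sub>i\<close>.\<close>

lemma cover_entropy_add_energy_le:
  assumes N: "1 \<le> N" and \<epsilon>: "0 < \<epsilon>" "\<epsilon> < 1" and U: "fine_cover N \<epsilon> n U"
    and J: "J = (\<lambda>x. LEAST i. x \<in> U i)"
  shows "shannon_entropy \<mu> J + ln (1 / \<epsilon>) * (\<integral>x. \<phi> N x \<partial>\<mu>) \<le> ln (cover_sum N \<epsilon> n U)"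
proof -
  have J_lt: "J x < n" and J_mem: "x \<in> U (J x)" and J_simple: "simple_function \<mu> J" for x
    using simple_function_cover_index[OF _ _ J, of n] U by blast+
  have J_meas: "J \<in> measurable \<mu> (count_space UNIV)"
    using J_simple by (rule measurable_simple_function)
  define c where "c i = (SUP x\<in>U i. \<phi> N x)" for i
  define P where "P i = measure \<mu> (J -` {i} \<inter> space \<mu>)" for i
  have sets_J: "J -` {i} \<inter> space \<mu> \<in> sets \<mu>" for i using measurable_sets[OF J_meas] by auto
  have sumP: "(\<Sum>i<n. P i) = 1"
  proof -
    have "(\<Sum>i<n. P i) = measure \<mu> (\<Union>i<n. J -` {i} \<inter> space \<mu>)"
      unfolding P_def using sets_J
      by (intro finite_measure_finite_Union[symmetric]) (auto simp: disjoint_family_on_def)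
    also have "(\<Union>i<n. J -` {i} \<inter> space \<mu>) = space \<mu>" using J_lt by auto
    finally show ?thesis using prob_space by simp
  qed
  have int_ind: "integrable \<mu> (\<lambda>x. indicator (J -` {i} \<inter> space \<mu>) x * c i)" for i
    using sets_J by (simp add: emeasure_eq_measure)
  have "(\<integral>x. \<phi> N x \<partial>\<mu>) \<le> (\<integral>x. (\<Sum>i<n. indicator (J -` {i} \<inter> space \<mu>) x * c i) \<partial>\<mu>)"
  proof (rule integral_mono[OF integrable_potential[OF N] Bochner_Integration.integrable_sum])
    fix x assume "x \<in> space \<mu>"
    have "\<phi> N x \<le> c (J x)"
      unfolding c_def by (intro cSUP_upper bdd_above_potential N J_mem)
    also have "\<dots> = (\<Sum>i<n. if i = J x then c i else 0)" using J_lt[of x] by simp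
    also have "\<dots> = (\<Sum>i<n. indicator (J -` {i} \<inter> space \<mu>) x * c i)"
      by (intro sum.cong) (auto simp: indicator_def space_mu)
    finally show "\<phi> N x \<le> (\<Sum>i<n. indicator (J -` {i} \<inter> space \<mu>) x * c i)" .
  qed (rule int_ind)
  also have "\<dots> = (\<Sum>i<n. P i * c i)"
    using int_ind sets_J by (subst Bochner_Integration.integral_sum) (auto simp: P_def)
  finally have energy: "(\<integral>x. \<phi> N x \<partial>\<mu>) \<le> (\<Sum>i<n. P i * c i)" .
  have L: "0 < ln (1 / \<epsilon>)" using \<epsilon> by simp
  have "shannon_entropy \<mu> J + ln (1 / \<epsilon>) * (\<integral>x. \<phi> N x \<partial>\<mu>)
      \<le> shannon_entropy \<mu> J + ln (1 / \<epsilon>) * (\<Sum>i<n. P i * c i)"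
    using energy L by (intro add_left_mono mult_left_mono) auto
  also have "\<dots> = - (\<Sum>i<n. P i * ln (P i)) + (\<Sum>i<n. P i * ln ((1 / \<epsilon>) powr c i))"
    unfolding shannon_entropy_finite[OF prob_space_axioms J_meas finite_lessThan[of n]
        image_subsetI[of _ J, OF lessThan_iff[THEN iffD2, OF J_lt]]]
    using \<epsilon> by (simp add: P_def ln_powr sum_distrib_left mult_ac)
  also have "\<dots> \<le> ln (\<Sum>i<n. (1 / \<epsilon>) powr c i)"
    using sumP \<epsilon> by (intro gibbs_inequality) (auto simp: P_def)
  finally show ?thesis by (simp add: c_def)
qed

text \<open>For each \<open>N\<close>, the bound is passed from single covers to their infimum in exponential form, as a
  lower bound on the cover sums themselves, since \<open>ln\<close> stands outside the infimum.\<close>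

lemma rate_distortion_add_mean_le_pressure:
  assumes \<epsilon>: "0 < \<epsilon>" "\<epsilon> < 1" and F: "potential_mean \<phi> \<mu> = ereal F"
  shows "rate_distortion T d \<mu> \<epsilon> + ereal (ln (1 / \<epsilon>) * F) \<le> pressure T d \<phi> \<epsilon>"
  unfolding pressure_eq_INF[OF \<epsilon>]
proof (rule INF_greatest)
  fix N :: nat assume "N \<in> {1..}"
  then have N: "1 \<le> N" by simp
  have bound: "rate_distortion T d \<mu> \<epsilon>
      \<le> ereal (ln (cover_sum N \<epsilon> n U) / real N - ln (1 / \<epsilon>) * F)" if U: "fine_cover N \<epsilon> n U" for n U
  proof -
    define J where "J = (\<lambda>x. LEAST i. x \<in> U i)"
    have "F * real N \<le> (\<integral>x. \<phi> N x \<partial>\<mu>)"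
      using potential_mean_le[OF N] N by (simp add: F field_simps)
    then have "ln (1 / \<epsilon>) * (F * real N) \<le> ln (1 / \<epsilon>) * (\<integral>x. \<phi> N x \<partial>\<mu>)"
      using \<epsilon> by (intro mult_left_mono) auto
    with cover_entropy_add_energy_le[OF N \<epsilon> U J_def]
    have "shannon_entropy \<mu> J + ln (1 / \<epsilon>) * (F * real N) \<le> ln (cover_sum N \<epsilon> n U)"
      by linarith
    then have "shannon_entropy \<mu> J / real N \<le> ln (cover_sum N \<epsilon> n U) / real N - ln (1 / \<epsilon>) * F"
      using N by (simp add: field_simps)
    then show ?thesis
      using rate_distortion_le_cover_entropy[OF N \<epsilon>(1) U J_def] by (meson ereal_less_eq(3) order_trans)
  qed
  show "rate_distortion T d \<mu> \<epsilon> + ereal (ln (1 / \<epsilon>) * F) \<le> ereal (ln (cs N \<epsilon>) / real N)"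
  proof (cases "rate_distortion T d \<mu> \<epsilon>")
    case (real r)
    have "exp ((r + ln (1 / \<epsilon>) * F) * real N) \<le> cs N \<epsilon>"
    proof (rule covering_sum_greatest[OF N \<epsilon>(1)])
      fix n U assume U: "fine_cover N \<epsilon> n U"
      have "0 < cover_sum N \<epsilon> n U"
        using covering_sum_pos[OF N \<epsilon>] cover_sum_ge[OF U] by linarith
      moreover have "(r + ln (1 / \<epsilon>) * F) * real N \<le> ln (cover_sum N \<epsilon> n U)"
        using bound[OF U] N unfolding real by (simp add: field_simps)
      ultimately show "exp ((r + ln (1 / \<epsilon>) * F) * real N) \<le> cover_sum N \<epsilon> n U"
        by (simp add: ln_ge_iff)
    qed
    then have "(r + ln (1 / \<epsilon>) * F) * real N \<le> ln (cs N \<epsilon>)"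
      using covering_sum_pos[OF N \<epsilon>] by (simp add: ln_ge_iff)
    then show ?thesis unfolding real using N by (simp add: field_simps)
  next
    case PInf
    obtain n U where "fine_cover N \<epsilon> n U" by (rule fine_cover_exists[OF N \<epsilon>(1)])
    from bound[OF this] show ?thesis using PInf by simp
  qed simp
qed

end


section \<open>The inequalities between the dimensions\<close>

theorem proposition1p1:
  fixes T :: "'a::topological_space \<Rightarrow> 'a"
    and d :: "'a \<Rightarrow> 'a \<Rightarrow> real"
    and \<mu> :: "'a measure"
    and \<phi> :: "nat \<Rightarrow> 'a \<Rightarrow> real"
  assumes "dynamical_system T"
    and "compatible_metric d"
    and "invariant_probability T \<mu>"
    and "subadditive_potential T \<phi>"
    and "potential_mean \<phi> \<mu> \<noteq> -\<infinity>"
  shows "upper_rdim T d \<mu> + potential_mean \<phi> \<mu> \<le> upper_mdim T d \<phi> \<and>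
         lower_rdim T d \<mu> + potential_mean \<phi> \<mu> \<le> lower_mdim T d \<phi>"
proof -
  interpret invariant_subadditive_system T d \<phi> \<mu>
    using assms by unfold_locales
  have "potential_mean \<phi> \<mu> \<noteq> \<infinity>" using potential_mean_le[of 1] by auto
  with assms(5) obtain F where F: "potential_mean \<phi> \<mu> = ereal F"
    by (cases "potential_mean \<phi> \<mu>") auto
  let ?r = "\<lambda>\<epsilon>. rate_distortion T d \<mu> \<epsilon> / ereal (ln (1 / \<epsilon>))"
  let ?p = "\<lambda>\<epsilon>. pressure T d \<phi> \<epsilon> / ereal (ln (1 / \<epsilon>))"
  have "?r \<epsilon> + ereal F \<le> ?p \<epsilon>" if \<epsilon>: "0 < \<epsilon>" "\<epsilon> < 1" for \<epsilon>
  proof -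
    define L where "L = ln (1 / \<epsilon>)"
    have L: "0 < L" using \<epsilon> by (simp add: L_def)
    have "rate_distortion T d \<mu> \<epsilon> / ereal L + ereal F = (rate_distortion T d \<mu> \<epsilon> + ereal (L * F)) / ereal L"
      using L by (cases "rate_distortion T d \<mu> \<epsilon>") (auto simp: field_simps)
    also have "\<dots> \<le> pressure T d \<phi> \<epsilon> / ereal L"
      using rate_distortion_add_mean_le_pressure[OF \<epsilon> F] L
      by (intro ereal_divide_right_mono) (auto simp: L_def)
    finally show ?thesis by (simp add: L_def)
  qed
  then have ev: "\<forall>\<^sub>F \<epsilon> in at_right 0. ?r \<epsilon> + ereal F \<le> ?p \<epsilon>"
    unfolding eventually_at_right_field by (intro exI[of _ 1]) auto
  show ?thesis
    unfolding upper_rdim_def upper_mdim_def lower_rdim_def lower_mdim_def F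
    using Limsup_mono[OF ev] Liminf_mono[OF ev]
    by (simp add: Limsup_add_ereal_right Liminf_add_ereal_right)
qed

end
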